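(* If $G$ is a series-parallel graph, then $\pi^\circ(G) \le 2$.
   Context: A graph is series-parallel if it can be turned into $K_2$ by a sequence of the following operations: (parallel operation) replacing a pair of parallel edges by a single edge joining their common endpoints; (series operation) replacing the pair of edges incident to a vertex of degree $2$, other than two distinguished vertices called source and sink, by a single edge joining the two other endpoints. A pair of non-adjacent edges is separated by a circular ordering of $V(G)$ if the endpoints of the two edges do not alternate in that circular ordering. The circular separation dimension $\pi^\circ(G)$ is the minimum number of circular orderings of $V(G)$ such that every pair of non-adjacent edges of $G$ is separated in at least one of them. *)

theory Defs
  imports Main "HOL-Library.Multiset"
begin

text \<open>
  The reductions create parallel edges, so graphs are finite loopless multigraphs: a vertex
  set together with a multiset of edges, each edge being a two-element set of vertices.
  A simple graph is the case in which every edge has multiplicity one.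
\<close>

type_synonym 'a mgraph = "'a set \<times> 'a set multiset"

abbreviation verts :: "'a mgraph \<Rightarrow> 'a set" where
  "verts G \<equiv> fst G"

abbreviation edges :: "'a mgraph \<Rightarrow> 'a set multiset" where
  "edges G \<equiv> snd G"

definition graph :: "'a mgraph \<Rightarrow> bool" where
  "graph G \<longleftrightarrow> finite (verts G) \<and> (\<forall>e\<in>#edges G. e \<subseteq> verts G \<and> card e = 2)"

definition degree :: "'a mgraph \<Rightarrow> 'a \<Rightarrow> nat" where
  "degree G v = size {#e \<in># edges G. v \<in> e#}"

definition is_K2 :: "'a mgraph \<Rightarrow> bool" where
  "is_K2 G \<longleftrightarrow> (\<exists>a b. a \<noteq> b \<and> G = ({a, b}, {#{a, b}#}))"

text \<open>
  The condition \<open>u \<noteq> w\<close> in the series operation keeps the graph loopless. It costs nothing: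
  a loop could never be removed by later operations, so \<open>K\<^sub>2\<close> would be out of reach.
\<close>

inductive sp_step :: "'a \<Rightarrow> 'a \<Rightarrow> 'a mgraph \<Rightarrow> 'a mgraph \<Rightarrow> bool" for s t where
  parallel: "sp_step s t (V, E + {#e, e#}) (V, E + {#e#})"
| series: "\<lbrakk>v \<in> V; v \<noteq> s; v \<noteq> t; u \<noteq> w; degree (V, E + {#{u, v}, {v, w}#}) v = 2\<rbrakk>
    \<Longrightarrow> sp_step s t (V, E + {#{u, v}, {v, w}#}) (V - {v}, E + {#{u, w}#})"

definition series_parallel :: "'a mgraph \<Rightarrow> bool" where
  "series_parallel G \<longleftrightarrow> graph G \<and>
    (\<exists>s\<in>verts G. \<exists>t\<in>verts G. s \<noteq> t \<and> (\<exists>H. (sp_step s t)\<^sup>*\<^sup>* G H \<and> is_K2 H))"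


text \<open>
  A circular ordering is a total cyclic order, where \<open>(a, b, c) \<in> C\<close> means that going around
  the circle in the positive direction from \<open>a\<close> one meets \<open>b\<close> before \<open>c\<close>. The second and third
  conditions force \<open>a\<close>, \<open>b\<close>, \<open>c\<close> to be pairwise distinct.
\<close>

definition circular_ordering :: "'a set \<Rightarrow> ('a \<times> 'a \<times> 'a) set \<Rightarrow> bool" where
  "circular_ordering V C \<longleftrightarrow>
    C \<subseteq> V \<times> V \<times> V \<and>
    (\<forall>a b c. (a, b, c) \<in> C \<longrightarrow> (b, c, a) \<in> C) \<and>
    (\<forall>a b c. (a, b, c) \<in> C \<longrightarrow> (c, b, a) \<notin> C) \<and>
    (\<forall>a b c d. (a, b, c) \<in> C \<longrightarrow> (a, c, d) \<in> C \<longrightarrow> (a, b, d) \<in> C) \<and>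
    (\<forall>a\<in>V. \<forall>b\<in>V. \<forall>c\<in>V. a \<noteq> b \<longrightarrow> b \<noteq> c \<longrightarrow> a \<noteq> c \<longrightarrow> (a, b, c) \<in> C \<or> (c, b, a) \<in> C)"

definition alternate :: "('a \<times> 'a \<times> 'a) set \<Rightarrow> 'a set \<Rightarrow> 'a set \<Rightarrow> bool" where
  "alternate C e f \<longleftrightarrow>
    (\<exists>a b c d. e = {a, b} \<and> f = {c, d} \<and> (a, c, b) \<in> C \<and> (b, d, a) \<in> C)"

definition separating_family :: "'a mgraph \<Rightarrow> ('a \<times> 'a \<times> 'a) set set \<Rightarrow> bool" where
  "separating_family G S \<longleftrightarrow>
    finite S \<and> (\<forall>C\<in>S. circular_ordering (verts G) C) \<and>
    (\<forall>e\<in>#edges G. \<forall>f\<in>#edges G. e \<inter> f = {} \<longrightarrow> (\<exists>C\<in>S. \<not> alternate C e f))"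

definition circular_separation_dimension :: "'a mgraph \<Rightarrow> nat" where
  "circular_separation_dimension G = (LEAST k. \<exists>S. separating_family G S \<and> card S = k)"

definition induced_circ :: "'a set \<Rightarrow> ('a \<Rightarrow> nat) \<Rightarrow> ('a \<times> 'a \<times> 'a) set" where
  "induced_circ V g = {(a, b, c). a \<in> V \<and> b \<in> V \<and> c \<in> V \<and>
     (g a < g b \<and> g b < g c \<or> g b < g c \<and> g c < g a \<or> g c < g a \<and> g a < g b)}"

lemma circular_ordering_induced_circ:
  assumes "inj_on g V"
  shows "circular_ordering V (induced_circ V g)"
proof -
  have "g a \<noteq> g b" if "a \<in> V" "b \<in> V" "a \<noteq> b" for a b
    using assms that by (meson inj_onD)
  then have tot: "(a, b, c) \<in> induced_circ V g \<or> (c, b, a) \<in> induced_circ V g"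
    if "a \<in> V" "b \<in> V" "c \<in> V" "a \<noteq> b" "b \<noteq> c" "a \<noteq> c" for a b c
    using that unfolding induced_circ_def
    by simp (metis linorder_neqE_nat)
  show ?thesis
    unfolding circular_ordering_def
    by (intro conjI) (use tot in \<open>auto simp: induced_circ_def\<close>)
qed

text \<open>Every graph has a separating family, so the minimum is taken over a nonempty set.\<close>

lemma ex_separating_family:
  assumes "graph G"
  shows "\<exists>S. separating_family G S"
proof -
  let ?V = "verts G"
  let ?S = "{C. circular_ordering ?V C}"
  have fin: "finite ?V" and ed: "\<And>e. e \<in># edges G \<Longrightarrow> e \<subseteq> ?V \<and> card e = 2"
    using assms by (auto simp: graph_def)
  have "?S \<subseteq> Pow (?V \<times> ?V \<times> ?V)"
    by (auto simp: circular_ordering_def)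
  then have finS: "finite ?S"
    using fin by (meson finite_Pow_iff finite_SigmaI finite_subset)
  obtain h :: "'a \<Rightarrow> nat" where h: "inj_on h ?V"
    using fin finite_imp_inj_to_nat_seg by blast
  have sep: "\<exists>C\<in>?S. \<not> alternate C e f"
    if e: "e \<in># edges G" and f: "f \<in># edges G" and disj: "e \<inter> f = {}" for e f
  proof -
    obtain a b where ab: "e = {a, b}" "a \<noteq> b"
      using ed[OF e] by (auto simp: card_2_iff)
    obtain c d where cd: "f = {c, d}" "c \<noteq> d"
      using ed[OF f] by (auto simp: card_2_iff)
    have ne: "a \<noteq> c" "a \<noteq> d" "b \<noteq> c" "b \<noteq> d"
      using disj ab cd by auto
    define g where "g = (\<lambda>x. h x + 4)(a := 0, b := 1, c := 2, d := 3)"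
    have inj: "inj_on g ?V"
      using h ab cd ne by (auto simp: g_def inj_on_def)
    have val: "g a = 0" "g b = 1" "g c = 2" "g d = 3"
      using ab cd ne by (auto simp: g_def)
    have "\<not> alternate (induced_circ ?V g) e f"
    proof
      assume "alternate (induced_circ ?V g) e f"
      then obtain p q r s where *: "e = {p, q}" "f = {r, s}"
        and in1: "(p, r, q) \<in> induced_circ ?V g" and in2: "(q, s, p) \<in> induced_circ ?V g"
        by (auto simp: alternate_def)
      have "p = a \<and> q = b \<or> p = b \<and> q = a" "r = c \<and> s = d \<or> r = d \<and> s = c"
        using * ab cd by (auto simp: doubleton_eq_iff)
      then show False
        using in1 in2 val by (auto simp: induced_circ_def)
    qed
    then show ?thesis
      using circular_ordering_induced_circ[OF inj] by blast
  qed
  show ?thesis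
    unfolding separating_family_def by (rule exI[of _ ?S]) (use finS sep in auto)
qed

end

theory Submission
  imports Defs
begin

text \<open>
  Undo the reductions one at a time, maintaining two circular orderings. When the series operation
  is undone, a vertex \<open>v\<close> with neighbours \<open>u\<close> and \<open>w\<close> is reinserted. Put \<open>v\<close> next to \<open>u\<close> in the
  first ordering and next to \<open>w\<close> in the second one: an edge whose endpoints are consecutive is
  crossed by nothing, so \<open>uv\<close> is separated from every other edge by the first ordering and \<open>vw\<close> by
  the second one, while the relative positions of the old vertices do not change.
\<close>

text \<open>The orderings are given by injective positions in the naturals, read cyclically through
  \<open>induced_circ\<close>, so that inserting a vertex becomes arithmetic.\<close>

definition separated_by_two :: "'a mgraph \<Rightarrow> bool" where
  "separated_by_two G \<longleftrightarrow> (\<exists>g h. inj_on g (verts G) \<and> inj_on h (verts G) \<and>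
    (\<forall>e\<in>#edges G. \<forall>f\<in>#edges G. e \<inter> f = {} \<longrightarrow>
      \<not> alternate (induced_circ (verts G) g) e f \<or> \<not> alternate (induced_circ (verts G) h) e f))"

text \<open>Doubling the old positions makes room for \<open>v\<close> immediately after \<open>u\<close>.\<close>

definition insert_after :: "'a \<Rightarrow> 'a \<Rightarrow> ('a \<Rightarrow> nat) \<Rightarrow> 'a \<Rightarrow> nat" where
  "insert_after u v g x = (if x = v then 2 * g u + 1 else 2 * g x)"

lemma inj_on_insert_after:
  assumes "inj_on g (V - {v})"
  shows "inj_on (insert_after u v g) V"
proof (rule inj_onI)
  fix x y
  assume "x \<in> V" "y \<in> V" "insert_after u v g x = insert_after u v g y"
  moreover have "2 * m + 1 \<noteq> 2 * n" for m n :: nat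
    by presburger
  ultimately show "x = y"
    using assms by (auto simp: insert_after_def inj_on_def split: if_splits) metis+
qed

lemma alternate_insert_after:
  assumes "alternate (induced_circ V (insert_after u v g)) e f" "v \<notin> e" "v \<notin> f"
  shows "alternate (induced_circ (V - {v}) g) e f"
proof -
  obtain a b c d where ef: "e = {a, b}" "f = {c, d}"
    and "(a, c, b) \<in> induced_circ V (insert_after u v g)"
    and "(b, d, a) \<in> induced_circ V (insert_after u v g)"
    using assms(1) by (auto simp: alternate_def)
  then have "(a, c, b) \<in> induced_circ (V - {v}) g" "(b, d, a) \<in> induced_circ (V - {v}) g"
    using assms(2,3) by (auto simp: induced_circ_def insert_after_def)
  then show ?thesis
    unfolding alternate_def using ef by blast
qed

text \<open>Both triples together place \<open>a\<close>, \<open>c\<close>, \<open>b\<close>,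
  \<open>d\<close> in this cyclic order, which can equally be read starting from
  \<open>c\<close>.\<close>

lemma alternate_induced_circ_commute:
  assumes "alternate (induced_circ V g) e f"
  shows "alternate (induced_circ V g) f e"
proof -
  obtain a b c d where ef: "e = {a, b}" "f = {c, d}"
    and "(a, c, b) \<in> induced_circ V g" "(b, d, a) \<in> induced_circ V g"
    using assms by (auto simp: alternate_def)
  then have "(c, b, d) \<in> induced_circ V g" "(d, a, c) \<in> induced_circ V g"
    by (auto simp: induced_circ_def)
  then show ?thesis
    unfolding alternate_def using ef by blast
qed

lemma not_alternate_insert_after:
  assumes "{u, v} \<inter> f = {}"
  shows "\<not> alternate (induced_circ V (insert_after u v g)) {u, v} f"
proof
  assume "alternate (induced_circ V (insert_after u v g)) {u, v} f"
  then obtain a b c d where ab: "{u, v} = {a, b}" and f: "f = {c, d}"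
    and mem: "(a, c, b) \<in> induced_circ V (insert_after u v g)"
      "(b, d, a) \<in> induced_circ V (insert_after u v g)"
    by (auto simp: alternate_def)
  \<comment> \<open>So \<open>c\<close> and \<open>d\<close> keep even positions, while alternation
    would put one of them strictly between \<open>2 * g u\<close> and
    \<open>2 * g u + 1\<close>.\<close>
  have "c \<noteq> v" "d \<noteq> v"
    using assms f by auto
  moreover have "a = u \<and> b = v \<or> a = v \<and> b = u"
    using ab by (auto simp: doubleton_eq_iff)
  ultimately show False
    using mem by (auto simp: induced_circ_def insert_after_def split: if_splits)
qed

lemma separated_by_two_step:
  assumes "sp_step s t G H" "separated_by_two H"
  shows "separated_by_two G"
  using assms
proof (cases rule: sp_step.cases)
  case (parallel V E e)
  \<comment> \<open>Separation depends only on which edges occur, not on their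
    multiplicities.\<close>
  then show ?thesis
    using assms(2) by (auto simp: separated_by_two_def)
next
  case (series v V u w E)
  obtain g h where inj: "inj_on g (V - {v})" "inj_on h (V - {v})"
    and sep: "\<And>e f. e \<in># E \<Longrightarrow> f \<in># E \<Longrightarrow> e \<inter> f = {} \<Longrightarrow>
      \<not> alternate (induced_circ (V - {v}) g) e f \<or> \<not> alternate (induced_circ (V - {v}) h) e f"
    using assms(2) series(2) by (auto simp: separated_by_two_def)
  \<comment> \<open>The edges \<open>{u, v}\<close> and \<open>{v, w}\<close> already account for
    the degree 2 of \<open>v\<close>.\<close>
  have notin: "v \<notin> e" if "e \<in># E" for e
    using series(7) that by (auto simp: degree_def)
  let ?C = "induced_circ V (insert_after u v g)" and ?D = "induced_circ V (insert_after w v h)"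
  have "\<not> alternate ?C e f \<or> \<not> alternate ?D e f"
    if mem: "e \<in># E + {#{u, v}, {v, w}#}" "f \<in># E + {#{u, v}, {v, w}#}" and disj: "e \<inter> f = {}" for e f
  proof -
    have new: "\<not> alternate ?C e f \<or> \<not> alternate ?D e f"
      if "e = {u, v} \<or> e = {v, w}" "e \<inter> f = {}" for e f
      using that not_alternate_insert_after[of u v f V g] not_alternate_insert_after[of w v f V h]
      by (auto simp: insert_commute)
    consider "e = {u, v} \<or> e = {v, w}" | "f = {u, v} \<or> f = {v, w}" | "e \<in># E" "f \<in># E"
      using mem by auto
    then show ?thesis
    proof cases
      case 1
      then show ?thesis using new disj by blast
    next
      case 2
      then show ?thesis
        using new[of f e] disj alternate_induced_circ_commute by (metis inf_commute)
    next
      case 3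
      then show ?thesis
        using sep disj notin alternate_insert_after by metis
    qed
  qed
  then show ?thesis
    unfolding separated_by_two_def series(1) fst_conv snd_conv
    using inj[THEN inj_on_insert_after] by blast
qed

lemma separated_by_two_K2:
  assumes "is_K2 G"
  shows "separated_by_two G"
proof -
  obtain a b where "a \<noteq> b" "G = ({a, b}, {#{a, b}#})"
    using assms by (auto simp: is_K2_def)
  then have "inj_on (\<lambda>x. if x = a then 0 else 1 :: nat) (verts G)"
    by (auto simp: inj_on_def)
  \<comment> \<open>With a single edge there is no disjoint pair to separate.\<close>
  moreover have "e \<inter> f \<noteq> {}" if "e \<in># edges G" "f \<in># edges G" for e f
    using that \<open>G = _\<close> by auto
  ultimately show ?thesis
    unfolding separated_by_two_def by blast
qed

lemma separated_by_two_imp_dimension: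
  assumes "separated_by_two G"
  shows "circular_separation_dimension G \<le> 2"
proof -
  obtain g h where inj: "inj_on g (verts G)" "inj_on h (verts G)"
    and sep: "\<forall>e\<in>#edges G. \<forall>f\<in>#edges G. e \<inter> f = {} \<longrightarrow>
      \<not> alternate (induced_circ (verts G) g) e f \<or> \<not> alternate (induced_circ (verts G) h) e f"
    using assms by (auto simp: separated_by_two_def)
  let ?S = "{induced_circ (verts G) g, induced_circ (verts G) h}"
  have "separating_family G ?S"
    using inj[THEN circular_ordering_induced_circ] sep by (auto simp: separating_family_def)
  then have "circular_separation_dimension G \<le> card ?S"
    unfolding circular_separation_dimension_def by (intro Least_le) blast
  \<comment> \<open>Only an inequality, as the two orderings may coincide.\<close>
  also have "card ?S \<le> 2"
    by (simp add: card_insert_if)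
  finally show ?thesis .
qed

theorem theorem2:
  fixes G :: "'a mgraph"
  assumes "series_parallel G"
  shows "circular_separation_dimension G \<le> 2"
proof -
  obtain s t H where "(sp_step s t)\<^sup>*\<^sup>* G H" "is_K2 H"
    using assms by (auto simp: series_parallel_def)
  then have "separated_by_two G"
    \<comment> \<open>The converse rule starts at \<open>H\<close> and prepends reductions, which
      matches undoing them from \<open>K2\<close> back to \<open>G\<close>.\<close>
    by (induction rule: converse_rtranclp_induct)
      (auto intro: separated_by_two_K2 separated_by_two_step)
  then show ?thesis
    by (rule separated_by_two_imp_dimension)
qed

end
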